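(* Let $x\in\mathbb{R}^4$ be a rest point of the mean field dynamics of a $2\times 2$ traffic game (two routes $a,b$, two players $1,2$), and let $\pi^{ir}=\pi^{ir}(x^i)$ be the corresponding Logit probabilities. Then $x$ is a stable point for the mean field dynamics if and only if $$\beta_1\beta_2\,\delta^2\,\pi^{1a}\pi^{1b}\pi^{2a}\pi^{2b}<1 .$$
   Context: $2\times2$ traffic game: players $i\in\{1,2\}$, routes $r\in\{a,b\}$, real travel times $C_1^r\le C_2^r$ for each route $r$, and parameters $\beta_1,\beta_2>0$. The state is $x=(x^{1a},x^{1b},x^{2a},x^{2b})\in\mathbb{R}^4$, with $x^i=(x^{ia},x^{ib})$. Logit probabilities: $\pi^{ir}(x^i)=\dfrac{e^{-\beta_i x^{ir}}}{e^{-\beta_i x^{ia}}+e^{-\beta_i x^{ib}}}$. Put $\delta^r=C_2^r-C_1^r\ge 0$ and $\delta=\delta^a+\delta^b$. With $j\ne i$ the other player, $C^{ir}(x^{j})=C_1^r+\delta^r\,\pi^{jr}(x^j)$ is the expected travel time of route $r$ for player $i$ given that $i$ chooses $r$. Mean field dynamics: $\dot x^{ir}=G^{ir}(x):=\pi^{ir}(x^i)\,\bigl(C^{ir}(x^{j})-x^{ir}\bigr)$ for $i\in\{1,2\}$, $r\in\{a,b\}$, $j\neq i$. A rest point is an $x$ with $x^{ir}=C^{ir}(x^j)$ for all $i,r$. A rest point $x$ is called stable if all eigenvalues of the Jacobian matrix $J(x)$ of $G$ at $x$ have strictly negative real part (linear stability). *)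

theory Defs
  imports "HOL-Analysis.Analysis"
begin

datatype player = P1 | P2
datatype route = Ra | Rb

lemma UNIV_player: "UNIV = {P1, P2}"
  using player.exhaust by auto

lemma UNIV_route: "UNIV = {Ra, Rb}"
  using route.exhaust by auto

instance player :: finite
  by standard (simp add: UNIV_player)

instance route :: finite
  by standard (simp add: UNIV_route)

fun other :: "player \<Rightarrow> player" where
  "other P1 = P2"
| "other P2 = P1"

text \<open>The four coordinates of a state are indexed by pairs of a player and a route:
  \<open>x $ (i, r)\<close> is $x^{ir}$.\<close>

type_synonym state = "real ^ (player \<times> route)"

definition logit :: "(player \<Rightarrow> real) \<Rightarrow> state \<Rightarrow> player \<Rightarrow> route \<Rightarrow> real" where
  "logit \<beta> x i r =
     exp (- \<beta> i * x $ (i, r)) / (exp (- \<beta> i * x $ (i, Ra)) + exp (- \<beta> i * x $ (i, Rb)))"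

text \<open>\<open>C1 r\<close> and \<open>C2 r\<close> are the travel times of route \<open>r\<close> when it is used by one
  and by two players, respectively.\<close>

definition delay :: "(route \<Rightarrow> real) \<Rightarrow> (route \<Rightarrow> real) \<Rightarrow> route \<Rightarrow> real" where
  "delay C1 C2 r = C2 r - C1 r"

definition total_delay :: "(route \<Rightarrow> real) \<Rightarrow> (route \<Rightarrow> real) \<Rightarrow> real" where
  "total_delay C1 C2 = delay C1 C2 Ra + delay C1 C2 Rb"

definition expected_time ::
  "(route \<Rightarrow> real) \<Rightarrow> (route \<Rightarrow> real) \<Rightarrow> (player \<Rightarrow> real) \<Rightarrow> state \<Rightarrow> player \<Rightarrow> route \<Rightarrow> real" where
  "expected_time C1 C2 \<beta> x i r = C1 r + delay C1 C2 r * logit \<beta> x (other i) r"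

definition mean_field ::
  "(route \<Rightarrow> real) \<Rightarrow> (route \<Rightarrow> real) \<Rightarrow> (player \<Rightarrow> real) \<Rightarrow> state \<Rightarrow> state" where
  "mean_field C1 C2 \<beta> x =
     (\<chi> k. case k of (i, r) \<Rightarrow> logit \<beta> x i r * (expected_time C1 C2 \<beta> x i r - x $ (i, r)))"

definition rest_point ::
  "(route \<Rightarrow> real) \<Rightarrow> (route \<Rightarrow> real) \<Rightarrow> (player \<Rightarrow> real) \<Rightarrow> state \<Rightarrow> bool" where
  "rest_point C1 C2 \<beta> x \<longleftrightarrow> (\<forall>i r. x $ (i, r) = expected_time C1 C2 \<beta> x i r)"

definition complex_eigenvalue :: "real ^ 'n ^ 'n \<Rightarrow> complex \<Rightarrow> bool" where
  "complex_eigenvalue A \<mu> \<longleftrightarrow>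
     (\<exists>v :: complex ^ 'n. v \<noteq> 0 \<and> map_matrix complex_of_real A *v v = \<mu> *s v)"

definition linearly_stable ::
  "(route \<Rightarrow> real) \<Rightarrow> (route \<Rightarrow> real) \<Rightarrow> (player \<Rightarrow> real) \<Rightarrow> state \<Rightarrow> bool" where
  "linearly_stable C1 C2 \<beta> x \<longleftrightarrow>
     (\<forall>\<mu>. complex_eigenvalue (jacobian (mean_field C1 C2 \<beta>) (at x)) \<mu> \<longrightarrow> Re \<mu> < 0)"

text \<open>\<^const>\<open>jacobian\<close> is only meaningful at points of differentiability; the mean
  field is differentiable everywhere.\<close>

lemma logit_differentiable: "(\<lambda>x. logit \<beta> x i r) differentiable (at x)"
proof -
  have e: "(\<lambda>x. exp (- \<beta> i * x $ (i, s))) differentiable (at x)" for s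
    unfolding differentiable_def
    by (rule exI, rule has_derivative_exp, rule has_derivative_mult_right,
        rule bounded_linear_imp_has_derivative, rule bounded_linear_vec_nth)
  show ?thesis
    unfolding logit_def
    by (rule differentiable_divide[OF e differentiable_add[OF e e]])
       (metis add_pos_pos exp_gt_zero less_irrefl)
qed

lemma mean_field_differentiable: "mean_field C1 C2 \<beta> differentiable (at x)"
proof -
  have p: "(\<lambda>x :: state. x $ k) differentiable (at x)" for k
    by (rule bounded_linear_imp_differentiable[OF bounded_linear_vec_nth])
  have c: "(\<lambda>x. mean_field C1 C2 \<beta> x $ k) differentiable (at x)" for k
    unfolding mean_field_def expected_time_def
    by (cases k) (simp add: p logit_differentiable)
  show ?thesis
    by (subst differentiable_componentwise_within)
       (auto simp: Basis_vec_def inner_axis c)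
qed

end

theory Submission
  imports Defs
begin

text \<open>At a rest point the factor \<open>C\<^sup>i\<^sup>r - x\<^sup>i\<^sup>r\<close> vanishes, so the
  Jacobian sends \<open>v\<close> to \<open>\<pi>\<^sup>i\<^sup>r (dC\<^sup>i\<^sup>r - v\<^sup>i\<^sup>r)\<close>, where the change \<open>dC\<^sup>i\<^sup>r\<close> of the expected time
  depends only on the other player's time difference \<open>u\<^sub>j = v\<^sup>j\<^sup>a - v\<^sup>j\<^sup>b\<close>.  An eigenvector equation can therefore be solved for the coordinates
  of player \<open>i\<close> in terms of \<open>u\<^sub>j\<close> alone, and taking differences leaves a loop of two scalar
  equations \<open>u\<^sub>i = - \<kappa>\<^sub>j F\<^sub>i(\<mu>) u\<^sub>j\<close> with
  \<open>\<kappa>\<^sub>i = \<beta>\<^sub>i \<pi>\<^sup>i\<^sup>a \<pi>\<^sup>i\<^sup>b\<close> (\<open>choice_slope\<close>) and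
  \<open>F\<^sub>i(\<mu>) = \<Sum>\<^sub>r \<delta>\<^sup>r \<pi>\<^sup>i\<^sup>r / (\<mu> + \<pi>\<^sup>i\<^sup>r)\<close> (\<open>delay_gain\<close>).  Hence a number with nonnegative
  real part is an eigenvalue iff \<open>\<kappa>\<^sub>1 \<kappa>\<^sub>2 F\<^sub>1(\<mu>) F\<^sub>2(\<mu>) = 1\<close>
  (\<open>complex_eigenvalue_iff_loop_gain\<close>).

  In the closed right half plane \<open>|F\<^sub>i| \<le> \<delta>\<close>, with \<open>F\<^sub>i(0) = \<delta>\<close>
  (\<open>norm_delay_gain_le\<close>, \<open>delay_gain_0\<close>).  If
  \<open>\<kappa>\<^sub>1 \<kappa>\<^sub>2 \<delta>\<^sup>2 < 1\<close>, the loop equation thus has no solution there.  Otherwise the left side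
  of the loop equation is at least 1 at \<open>\<mu> = 0\<close> and decays along the positive real axis, so it
  equals 1 at some real \<open>\<mu> \<ge> 0\<close> (\<open>loop_gain_eq_1_real\<close>).\<close>

section \<open>Logit probabilities and their derivatives\<close>

definition choice_slope :: "(player \<Rightarrow> real) \<Rightarrow> state \<Rightarrow> player \<Rightarrow> real" where
  "choice_slope \<beta> x i = \<beta> i * logit \<beta> x i Ra * logit \<beta> x i Rb"

text \<open>A longer time on route \<open>a\<close> relative to \<open>b\<close> makes \<open>a\<close> less likely and \<open>b\<close> more
  likely, by the same amount because the two probabilities sum to 1.\<close>

definition route_sign :: "route \<Rightarrow> real" where
  "route_sign r = (case r of Ra \<Rightarrow> -1 | Rb \<Rightarrow> 1)"

lemma route_sign_simps [simp]: "route_sign Ra = -1" "route_sign Rb = 1"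
  by (simp_all add: route_sign_def)

lemma logit_pos: "logit \<beta> x i r > 0"
  by (simp add: logit_def add_pos_pos)

lemma choice_slope_nonneg:
  assumes "\<beta> i > 0"
  shows "choice_slope \<beta> x i \<ge> 0"
  using assms logit_pos[of \<beta> x i] by (simp add: choice_slope_def less_imp_le)

lemma has_derivative_logit:
  "((\<lambda>y. logit \<beta> y i r) has_derivative
     (\<lambda>v. route_sign r * choice_slope \<beta> x i * (v $ (i, Ra) - v $ (i, Rb)))) (at x)"
proof -
  define E where "E s = exp (- \<beta> i * x $ (i, s))" for s
  have E_pos: "E s > 0" for s
    by (simp add: E_def)
  have dE: "((\<lambda>y :: state. exp (- \<beta> i * y $ (i, s))) has_derivative
      (\<lambda>v. - \<beta> i * v $ (i, s) * E s)) (at x)" for s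
    unfolding E_def
    by (rule derivative_eq_intros bounded_linear_imp_has_derivative[OF bounded_linear_vec_nth]
          refl)+ (simp add: fun_eq_iff)
  have "E Ra + E Rb \<noteq> 0"
    using E_pos[of Ra] E_pos[of Rb] by linarith
  then have dq: "((\<lambda>y. logit \<beta> y i r) has_derivative
      (\<lambda>v. ((- \<beta> i * v $ (i, r) * E r) * (E Ra + E Rb)
         - E r * (- \<beta> i * v $ (i, Ra) * E Ra + - \<beta> i * v $ (i, Rb) * E Rb))
         / ((E Ra + E Rb) * (E Ra + E Rb)))) (at x)"
    unfolding logit_def
    using has_derivative_divide'[OF dE[of r] has_derivative_add[OF dE[of Ra] dE[of Rb]]]
    by (simp add: E_def)
  have slope: "choice_slope \<beta> x i = \<beta> i * E Ra * E Rb / ((E Ra + E Rb) * (E Ra + E Rb))"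
    by (simp add: choice_slope_def logit_def E_def)
  show ?thesis
    by (rule has_derivative_eq_rhs[OF dq], cases r)
       (simp_all add: fun_eq_iff slope algebra_simps minus_divide_left
         flip: add_divide_distrib diff_divide_distrib del: divide_minus_left)
qed

section \<open>The Jacobian at a rest point\<close>

text \<open>In the product rule, the term that differentiates the probability is multiplied by
  \<open>C\<^sup>i\<^sup>r - x\<^sup>i\<^sup>r = 0\<close>.\<close>

lemma has_derivative_mean_field_rest_point:
  assumes "rest_point C1 C2 \<beta> x"
  shows "(mean_field C1 C2 \<beta> has_derivative
     (\<lambda>v. \<chi> k. case k of (i, r) \<Rightarrow> logit \<beta> x i r *
        (delay C1 C2 r * (route_sign r * choice_slope \<beta> x (other i) *
           (v $ (other i, Ra) - v $ (other i, Rb))) - v $ (i, r)))) (at x)"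
    (is "(_ has_derivative ?D) _")
proof -
  have comp: "((\<lambda>y. mean_field C1 C2 \<beta> y $ (i, r)) has_derivative (\<lambda>v. ?D v $ (i, r))) (at x)"
    for i r
  proof -
    have rest: "expected_time C1 C2 \<beta> x i r - x $ (i, r) = 0"
      using assms by (simp add: rest_point_def)
    have "((\<lambda>y. expected_time C1 C2 \<beta> y i r - y $ (i, r)) has_derivative
        (\<lambda>v. delay C1 C2 r * (route_sign r * choice_slope \<beta> x (other i) *
           (v $ (other i, Ra) - v $ (other i, Rb))) - v $ (i, r))) (at x)"
      unfolding expected_time_def
      by (rule derivative_eq_intros has_derivative_logit
            bounded_linear_imp_has_derivative[OF bounded_linear_vec_nth] refl)+ simp
    from has_derivative_mult[OF has_derivative_logit this, of \<beta> i r] show ?thesis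
      by (simp add: mean_field_def rest)
  qed
  show ?thesis
    using comp
    by (subst has_derivative_componentwise_within) (auto simp: Basis_vec_def inner_axis)
qed

lemma UNIV_coordinates: "(UNIV :: (player \<times> route) set) = {P1, P2} \<times> {Ra, Rb}"
  by (simp add: UNIV_player UNIV_route flip: UNIV_Times_UNIV)

lemma jacobian_mult_complex:
  assumes "rest_point C1 C2 \<beta> x"
  shows "(map_matrix complex_of_real (jacobian (mean_field C1 C2 \<beta>) (at x)) *v v) $ (i, r) =
     of_real (logit \<beta> x i r) *
        (of_real (delay C1 C2 r * route_sign r * choice_slope \<beta> x (other i)) *
           (v $ (other i, Ra) - v $ (other i, Rb)) - v $ (i, r))"
  unfolding jacobian_def
    frechet_derivative_at[OF has_derivative_mean_field_rest_point[OF assms], symmetric]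
  by (cases i; cases r)
     (simp_all add: matrix_vector_mult_def map_matrix_def matrix_def axis_def UNIV_coordinates
       algebra_simps)

section \<open>Eigenvalues in the closed right half plane\<close>

definition delay_gain ::
  "(route \<Rightarrow> real) \<Rightarrow> (route \<Rightarrow> real) \<Rightarrow> (player \<Rightarrow> real) \<Rightarrow> state \<Rightarrow> player \<Rightarrow> 'a \<Rightarrow> 'a::real_normed_field"
where
  "delay_gain C1 C2 \<beta> x i \<mu> =
     of_real (delay C1 C2 Ra * logit \<beta> x i Ra) / (\<mu> + of_real (logit \<beta> x i Ra)) +
     of_real (delay C1 C2 Rb * logit \<beta> x i Rb) / (\<mu> + of_real (logit \<beta> x i Rb))"

lemma add_of_real_ne_0:
  assumes "Re \<mu> \<ge> 0" "p > 0"
  shows "\<mu> + of_real p \<noteq> 0"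
  using assms by (auto simp: complex_eq_iff)

text \<open>Restricting to the closed right half plane keeps every \<open>\<mu> + \<pi>\<^sup>i\<^sup>r\<close> away from 0, which is
  what makes the elimination of the four coordinates in favour of the two time differences
  reversible.\<close>

lemma complex_eigenvalue_iff_loop_gain:
  assumes rest: "rest_point C1 C2 \<beta> x" and \<mu>: "Re \<mu> \<ge> 0"
  shows "complex_eigenvalue (jacobian (mean_field C1 C2 \<beta>) (at x)) \<mu> \<longleftrightarrow>
     of_real (choice_slope \<beta> x P1 * choice_slope \<beta> x P2) *
       delay_gain C1 C2 \<beta> x P1 \<mu> * delay_gain C1 C2 \<beta> x P2 \<mu> = 1"
    (is "complex_eigenvalue ?J \<mu> \<longleftrightarrow> ?loop = 1")
proof -
  let ?p = "\<lambda>i r. complex_of_real (logit \<beta> x i r)"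
  let ?c = "\<lambda>i r. complex_of_real (delay C1 C2 r * route_sign r * choice_slope \<beta> x (other i))"
  let ?F = "\<lambda>i. delay_gain C1 C2 \<beta> x i \<mu>"
  let ?k = "\<lambda>i. complex_of_real (choice_slope \<beta> x i)"
  have ne: "\<mu> + ?p i r \<noteq> 0" for i r
    by (rule add_of_real_ne_0[OF \<mu> logit_pos])
  have eigenvector_iff: "map_matrix complex_of_real ?J *v v = \<mu> *s v \<longleftrightarrow>
      (\<forall>i r. v $ (i, r) =
        ?p i r * ?c i r / (\<mu> + ?p i r) * (v $ (other i, Ra) - v $ (other i, Rb)))" for v
  proof -
    have "map_matrix complex_of_real ?J *v v = \<mu> *s v \<longleftrightarrow>
        (\<forall>i r. ?p i r * (?c i r * (v $ (other i, Ra) - v $ (other i, Rb)) - v $ (i, r)) =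
           \<mu> * v $ (i, r))"
      by (simp add: vec_eq_iff jacobian_mult_complex[OF rest])
    also have "\<dots> \<longleftrightarrow> (\<forall>i r. v $ (i, r) =
        ?p i r * ?c i r / (\<mu> + ?p i r) * (v $ (other i, Ra) - v $ (other i, Rb)))"
      using ne by (simp add: field_simps) (metis add.commute)
    finally show ?thesis .
  qed
  have gain_diff: "?p i Ra * ?c i Ra / (\<mu> + ?p i Ra) * u - ?p i Rb * ?c i Rb / (\<mu> + ?p i Rb) * u =
      - ?k (other i) * ?F i * u" for i u
    by (simp add: delay_gain_def algebra_simps add_divide_distrib)
  show ?thesis
  proof
    assume "complex_eigenvalue ?J \<mu>"
    then obtain v where "v \<noteq> 0" and
      v: "\<And>i r. v $ (i, r) =
        ?p i r * ?c i r / (\<mu> + ?p i r) * (v $ (other i, Ra) - v $ (other i, Rb))"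
      unfolding complex_eigenvalue_def eigenvector_iff by blast
    define u where "u i = v $ (i, Ra) - v $ (i, Rb)" for i
    have u: "u i = - ?k (other i) * ?F i * u (other i)" for i
      unfolding gain_diff[symmetric] u_def using v by metis
    have "u P1 \<noteq> 0"
    proof
      assume "u P1 = 0"
      moreover from this have "u P2 = 0"
        using u[of P2] by simp
      ultimately have "u i = 0" for i
        by (cases i) auto
      then have "v $ (i, r) = 0" for i r
        by (subst v) (simp flip: u_def)
      with \<open>v \<noteq> 0\<close> show False
        by (simp add: vec_eq_iff)
    qed
    moreover have "u P1 = ?loop * u P1"
      using u[of P1] u[of P2] by (simp add: ac_simps)
    ultimately show "?loop = 1"
      by simp
  next
    assume loop: "?loop = 1"
    \<comment> \<open>The eigenvector is normalised so that player 2 has time difference 1.\<close>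
    define u where "u i = (case i of P1 \<Rightarrow> - ?k P2 * ?F P1 | P2 \<Rightarrow> 1)" for i
    define v :: "complex ^ (player \<times> route)"
      where "v = (\<chi> k. case k of (i, r) \<Rightarrow> ?p i r * ?c i r / (\<mu> + ?p i r) * u (other i))"
    have "- ?k (other i) * ?F i * u (other i) = u i" for i
      using loop by (cases i) (simp_all add: u_def ac_simps)
    then have diff: "v $ (i, Ra) - v $ (i, Rb) = u i" for i
      using gain_diff[of i "u (other i)"] by (simp add: v_def)
    have "v $ (P2, Ra) - v $ (P2, Rb) = 1"
      using diff[of P2] by (simp add: u_def)
    then have "v \<noteq> 0"
      by auto
    moreover have "map_matrix complex_of_real ?J *v v = \<mu> *s v"
      unfolding eigenvector_iff diff by (simp add: v_def)
    ultimately show "complex_eigenvalue ?J \<mu>"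
      unfolding complex_eigenvalue_def by blast
  qed
qed

section \<open>Size of the gain\<close>

lemma delay_gain_0: "delay_gain C1 C2 \<beta> x i (0::real) = total_delay C1 C2"
  using logit_pos[of \<beta> x i] by (simp add: delay_gain_def total_delay_def less_imp_neq[symmetric])

text \<open>Adding \<open>\<mu>\<close> with nonnegative real part to the positive number \<open>\<pi>\<^sup>i\<^sup>r\<close> cannot decrease its
  modulus.\<close>

lemma norm_delay_gain_le:
  assumes "\<And>r. C1 r \<le> C2 r" and \<mu>: "Re \<mu> \<ge> 0"
  shows "norm (delay_gain C1 C2 \<beta> x i \<mu>) \<le> total_delay C1 C2"
proof -
  have "norm (of_real (delay C1 C2 r * logit \<beta> x i r) / (\<mu> + of_real (logit \<beta> x i r)))
      \<le> delay C1 C2 r" for r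
  proof -
    let ?p = "logit \<beta> x i r"
    have "?p \<le> norm (\<mu> + of_real ?p)"
      using \<mu> complex_Re_le_cmod[of "\<mu> + of_real ?p"] by simp
    moreover have "delay C1 C2 r \<ge> 0"
      using assms(1) by (simp add: delay_def)
    moreover have "?p > 0"
      by (rule logit_pos)
    ultimately show ?thesis
      by (simp add: norm_divide norm_mult divide_le_eq mult_left_mono)
  qed
  from this[of Ra] this[of Rb] show ?thesis
    unfolding delay_gain_def total_delay_def by (intro norm_triangle_le) simp
qed

lemma delay_gain_real_bounds:
  fixes \<mu> :: real
  assumes "\<And>r. C1 r \<le> C2 r" and "\<mu> > 0"
  shows "0 \<le> delay_gain C1 C2 \<beta> x i \<mu>" "delay_gain C1 C2 \<beta> x i \<mu> \<le> total_delay C1 C2 / \<mu>"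
proof -
  have d: "delay C1 C2 r \<ge> 0" for r
    using assms(1) by (simp add: delay_def)
  have p: "0 < logit \<beta> x i r" "logit \<beta> x i r \<le> 1" for r
    by (simp add: logit_pos) (cases r; simp add: logit_def add_pos_pos)
  show "0 \<le> delay_gain C1 C2 \<beta> x i \<mu>"
    using d p(1) assms(2) by (simp add: delay_gain_def add_nonneg_nonneg less_imp_le)
  have "delay C1 C2 r * logit \<beta> x i r / (\<mu> + logit \<beta> x i r) \<le> delay C1 C2 r / \<mu>" for r
    using d[of r] p[of r] assms(2)
    by (intro frac_le) (simp_all add: mult_left_le)
  from this[of Ra] this[of Rb] show "delay_gain C1 C2 \<beta> x i \<mu> \<le> total_delay C1 C2 / \<mu>"
    by (simp add: delay_gain_def total_delay_def add_divide_distrib)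
qed

lemma continuous_on_delay_gain: "continuous_on {0..} (delay_gain C1 C2 \<beta> x i :: real \<Rightarrow> real)"
proof -
  have "\<mu> + logit \<beta> x i r \<noteq> 0" if "\<mu> \<ge> 0" for \<mu> r
    using that logit_pos[of \<beta> x i r] by linarith
  then show ?thesis
    unfolding delay_gain_def by (intro continuous_intros) auto
qed

lemma loop_gain_eq_1_real:
  assumes "\<And>r. C1 r \<le> C2 r" and "k \<ge> 0" and K: "k * (total_delay C1 C2)\<^sup>2 \<ge> 1"
  shows "\<exists>\<mu>::real \<ge> 0. k * delay_gain C1 C2 \<beta> x P1 \<mu> * delay_gain C1 C2 \<beta> x P2 \<mu> = 1"
proof -
  let ?D = "total_delay C1 C2"
  let ?F = "\<lambda>i. delay_gain C1 C2 \<beta> x i :: real \<Rightarrow> real"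
  \<comment> \<open>Each gain is at most \<open>\<delta> / \<mu>\<close>, so the loop gain at \<open>M\<close> is at most
      \<open>M / M\<^sup>2\<close>, which does not exceed 1; the intermediate value theorem then applies
      between 0 and \<open>M\<close>.\<close>
  define M where "M = k * ?D\<^sup>2"
  have "M \<ge> 1"
    using K by (simp add: M_def)
  then have "M > 0"
    by simp
  note b = delay_gain_real_bounds[of C1 C2, OF assms(1) \<open>M > 0\<close>, of \<beta> x]
  have "k * (?F P1 M * ?F P2 M) \<le> k * (?D / M * (?D / M))"
    by (intro mult_left_mono mult_mono b assms(2) order_trans[OF b])
  also have "\<dots> = M / M\<^sup>2"
    by (simp add: M_def power2_eq_square)
  also have "\<dots> \<le> 1"
    using \<open>M \<ge> 1\<close> by (simp add: power2_eq_square)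
  finally have "k * ?F P1 M * ?F P2 M \<le> 1"
    by (simp add: mult.assoc)
  moreover have "1 \<le> k * ?F P1 0 * ?F P2 0"
    using K by (simp add: delay_gain_0 power2_eq_square mult.assoc)
  moreover have "continuous_on {0..M} (\<lambda>\<mu>. k * ?F P1 \<mu> * ?F P2 \<mu>)"
    by (intro continuous_intros continuous_on_subset[OF continuous_on_delay_gain]) auto
  ultimately show ?thesis
    using IVT2'[of "\<lambda>\<mu>. k * ?F P1 \<mu> * ?F P2 \<mu>" M 1 0] \<open>M > 0\<close> by auto
qed

section \<open>The stability criterion\<close>

theorem theorem1:
  fixes C1 C2 :: "route \<Rightarrow> real" and \<beta> :: "player \<Rightarrow> real" and x :: state
  assumes "\<And>r. C1 r \<le> C2 r"
    and "\<And>i. \<beta> i > 0"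
    and "rest_point C1 C2 \<beta> x"
  shows "linearly_stable C1 C2 \<beta> x \<longleftrightarrow>
    \<beta> P1 * \<beta> P2 * (total_delay C1 C2)^2
      * logit \<beta> x P1 Ra * logit \<beta> x P1 Rb * logit \<beta> x P2 Ra * logit \<beta> x P2 Rb < 1"
proof -
  define k where "k = choice_slope \<beta> x P1 * choice_slope \<beta> x P2"
  let ?D = "total_delay C1 C2"
  let ?F = "\<lambda>i. delay_gain C1 C2 \<beta> x i"
  have k: "k \<ge> 0"
    using choice_slope_nonneg assms(2) by (simp add: k_def)
  note eigen_iff = complex_eigenvalue_iff_loop_gain[OF assms(3), folded k_def]
  have "linearly_stable C1 C2 \<beta> x \<longleftrightarrow> k * ?D\<^sup>2 < 1"
  proof
    assume stable: "linearly_stable C1 C2 \<beta> x"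
    show "k * ?D\<^sup>2 < 1"
    proof (rule ccontr)
      assume "\<not> k * ?D\<^sup>2 < 1"
      then obtain \<mu> :: real where \<mu>: "\<mu> \<ge> 0" "k * ?F P1 \<mu> * ?F P2 \<mu> = 1"
        using loop_gain_eq_1_real[of C1 C2, OF assms(1) k, of \<beta> x] by auto
      have F: "?F i (complex_of_real \<mu>) = of_real (?F i \<mu>)" for i
        by (simp add: delay_gain_def)
      have "of_real k * ?F P1 (complex_of_real \<mu>) * ?F P2 (complex_of_real \<mu>) = 1"
        unfolding F using \<mu>(2) by (metis of_real_1 of_real_mult)
      then have "complex_eigenvalue (jacobian (mean_field C1 C2 \<beta>) (at x)) (of_real \<mu>)"
        using eigen_iff[of "of_real \<mu>"] \<mu>(1) by simp
      with stable \<mu>(1) show False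
        by (auto simp: linearly_stable_def)
    qed
  next
    assume small: "k * ?D\<^sup>2 < 1"
    show "linearly_stable C1 C2 \<beta> x"
      unfolding linearly_stable_def
    proof (intro allI impI, rule ccontr)
      fix \<mu>
      assume "complex_eigenvalue (jacobian (mean_field C1 C2 \<beta>) (at x)) \<mu>" "\<not> Re \<mu> < 0"
      then have \<mu>: "Re \<mu> \<ge> 0" and loop: "of_real k * ?F P1 \<mu> * ?F P2 \<mu> = 1"
        using eigen_iff[of \<mu>] by auto
      note F = norm_delay_gain_le[of C1 C2, OF assms(1) \<mu>, of \<beta> x]
      have "1 = norm (of_real k * ?F P1 \<mu> * ?F P2 \<mu>)"
        by (simp add: loop)
      also have "\<dots> = k * (norm (?F P1 \<mu>) * norm (?F P2 \<mu>))"
        using k by (simp add: norm_mult)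
      also have "\<dots> \<le> k * (?D * ?D)"
        by (intro mult_left_mono mult_mono F k order_trans[OF norm_ge_zero F]) simp
      finally show False
        using small by (simp add: power2_eq_square)
    qed
  qed
  then show ?thesis
    by (simp add: k_def choice_slope_def ac_simps)
qed

end
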